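(* Let $X$ be a Hilbert space and $T:X\to X$ a nonexpansive mapping with $Fix(T)\ne\emptyset$. Let $J\in\mathbb{N}$, $J\ge2$, $L\in\mathbb{N}^*$, $\lambda\in\left(0,\frac{J^2-1}{J^2}\right)$, $r^*\in X$, $x\in X$, and let $(x_n)$ be given by $$x_0=x,\quad x_{n+1}=\lambda x_n+\left(1-\lambda-\frac1{(n+J)^2}\right)Tx_n+\frac1{(n+L)^2}r^*\quad\text{for all }n\in\mathbb{N}.$$ Let $\Lambda=\left\lceil\frac1{\lambda(1-\lambda)}\right\rceil$ and let $b\in\mathbb{N}^*$ be such that $b\ge\max\{\|x-z\|,\|z\|\}$ for some fixed point $z$ of $T$. Then $(x_n)$ is $T$-asymptotically regular with rate $$\Phi(k)=16\Lambda M_1(k+1)^2+16\Lambda M_2(k+1)+3\Lambda-1$$ and asymptotically regular with rate $$\Psi(k)=64\Lambda M_1(k+1)^2+32\Lambda M_2(k+1)+3\Lambda-1,$$ where $M_1=(3b+2\lceil\|r^*\|\rceil)(5b+4\lceil\|r^*\|\rceil+1)$ and $M_2=2b+\lceil\|r^*\|\rceil$.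
   Context: $\mathbb{N}=\{0,1,2,\dots\}$, $\mathbb{N}^*=\mathbb{N}\setminus\{0\}$. $T$ is nonexpansive if $\|Tx-Ty\|\le\|x-y\|$ for all $x,y$; $Fix(T)$ is its set of fixed points. A function $\varphi:\mathbb{N}\to\mathbb{N}$ is a rate of convergence of a real sequence $(a_n)$ towards $0$ if for all $k\in\mathbb{N}$, $|a_n|\le\frac1{k+1}$ for all $n\ge\varphi(k)$. $(x_n)$ is $T$-asymptotically regular with rate $\Phi$ if $\Phi$ is a rate of convergence of $(\|x_n-Tx_n\|)$ towards $0$; it is asymptotically regular with rate $\Psi$ if $\Psi$ is a rate of convergence of $(\|x_{n+1}-x_n\|)$ towards $0$. *)

theory Defs
  imports "HOL-Analysis.Analysis"
begin

definition nonexpansive :: "('a::real_normed_vector \<Rightarrow> 'a) \<Rightarrow> bool" where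
  "nonexpansive T \<longleftrightarrow> (\<forall>x y. norm (T x - T y) \<le> norm (x - y))"

definition Fix :: "('a \<Rightarrow> 'a) \<Rightarrow> 'a set" where
  "Fix T = {x. T x = x}"

definition rate_of_convergence_to_0 :: "(nat \<Rightarrow> nat) \<Rightarrow> (nat \<Rightarrow> real) \<Rightarrow> bool" where
  "rate_of_convergence_to_0 \<phi> a \<longleftrightarrow> (\<forall>k. \<forall>n\<ge>\<phi> k. \<bar>a n\<bar> \<le> 1 / (real k + 1))"

definition T_asymptotically_regular_with_rate ::
  "('a::real_normed_vector \<Rightarrow> 'a) \<Rightarrow> (nat \<Rightarrow> 'a) \<Rightarrow> (nat \<Rightarrow> nat) \<Rightarrow> bool" where
  "T_asymptotically_regular_with_rate T X \<Phi> \<longleftrightarrow>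
     rate_of_convergence_to_0 \<Phi> (\<lambda>n. norm (X n - T (X n)))"

definition asymptotically_regular_with_rate ::
  "(nat \<Rightarrow> 'a::real_normed_vector) \<Rightarrow> (nat \<Rightarrow> nat) \<Rightarrow> bool" where
  "asymptotically_regular_with_rate X \<Psi> \<longleftrightarrow>
     rate_of_convergence_to_0 \<Psi> (\<lambda>n. norm (X (Suc n) - X n))"

end

theory Submission
  imports Defs
begin

text \<open>
  The residuals \<open>d n = norm (X n - T (X n))\<close> increase by at most \<open>O(1/n\<^sup>2)\<close> per step, so
  \<open>d n + C/n\<close> is decreasing. By the parallelogram-type identity for convex combinations,
  \<open>(norm (X n - z))\<^sup>2 + C'/n\<close> drops by at least \<open>lam (1 - lam - \<delta> n) (d n)\<^sup>2\<close> in each step, so a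
  long enough window contains an index with a small residual, and the first fact propagates
  this to all later indices. Finally \<open>\<Psi> k = \<Phi> (2 k + 1)\<close>, and \<open>norm (X (n + 1) - X n)\<close>
  exceeds \<open>d n\<close> by at most \<open>O(1/n\<^sup>2)\<close>.
\<close>

text \<open>For \<open>s + t = 1\<close> this is the classical identity for convex combinations.
  General weights are allowed because the iteration uses weights summing to
  \<open>1 - \<delta> n\<close>.\<close>

lemma norm_scaleR_add_sq:
  fixes u v :: "'a::real_inner"
  shows "(norm (s *\<^sub>R u + t *\<^sub>R v))\<^sup>2 =
    s * (s + t) * (norm u)\<^sup>2 + t * (s + t) * (norm v)\<^sup>2 - s * t * (norm (u - v))\<^sup>2"
  unfolding power2_norm_eq_inner
  by (simp add: inner_add inner_diff inner_commute algebra_simps)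

text \<open>Allows an error of order 1/n^2 to be absorbed into a potential by adding a term
  C/n.\<close>

lemma inverse_square_le_telescope:
  assumes "n \<ge> 1"
  shows "1 / (real n + 1)\<^sup>2 \<le> 1 / real n - 1 / real (Suc n)"
proof -
  have "1 / (real n + 1)\<^sup>2 \<le> 1 / (real n * (real n + 1))"
    using assms unfolding power2_eq_square by (intro divide_left_mono mult_right_mono) auto
  also have "\<dots> = 1 / real n - 1 / real (Suc n)"
    using assms by (simp add: field_simps)
  finally show ?thesis .
qed

text \<open>Pigeonhole: if every \<open>g n\<close> in a window of length \<open>W\<close> exceeded
  \<open>p m / W\<close>, the total drop would exceed \<open>p m\<close>, against
  \<open>p \<ge> 0\<close>.\<close>

lemma decreasing_imp_small_drop:
  fixes p g :: "nat \<Rightarrow> real"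
  assumes drop: "\<And>n. n \<ge> m \<Longrightarrow> p (Suc n) + g n \<le> p n"
    and nonneg: "\<And>n. p n \<ge> 0"
    and "W > 0"
  shows "\<exists>n. m \<le> n \<and> n < m + W \<and> real W * g n \<le> p m"
proof (rule ccontr)
  assume "\<not> ?thesis"
  then have big: "p m < real W * g n" if "m \<le> n" "n < m + W" for n
    using that by force
  have "p (m + i) + real i * (p m / real W) \<le> p m" if "i \<le> W" for i
    using that
  proof (induction i)
    case (Suc i)
    have "p m / real W < g (m + i)"
      using big[of "m + i"] Suc.prems \<open>W > 0\<close> by (simp add: field_simps)
    with drop[of "m + i"] Suc show ?case
      by (simp add: algebra_simps add_divide_distrib)
  qed simp
  \<comment> \<open>The induction loses strictness, and \<open>i = W\<close> would only give
    \<open>p (m + W) \<le> 0\<close>, no contradiction. Stopping one step earlier leaves the last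
    drop to be used with its strict bound.\<close>
  from this[of "W - 1"] \<open>W > 0\<close>
  have "p (m + (W - 1)) \<le> p m / real W"
    by (simp add: of_nat_diff field_simps)
  also have "\<dots> < g (m + (W - 1))"
    using big[of "m + (W - 1)"] \<open>W > 0\<close> by (simp add: field_simps)
  finally show False
    using drop[of "m + (W - 1)"] nonneg[of "Suc (m + (W - 1))"] by simp
qed

text \<open>The iteration is a Krasnoselskii-Mann step with a weight deficit
  \<open>\<delta> n\<close> and an additive error \<open>\<rho> n\<close>. Bounding both by
  multiples of 1/(n+1)^2 treats all shifts \<open>J\<close> and \<open>L\<close> uniformly.\<close>

locale perturbed_krasnoselskii_mann =
  fixes T :: "'a::real_inner \<Rightarrow> 'a"
    and X \<rho> :: "nat \<Rightarrow> 'a"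
    and \<delta> :: "nat \<Rightarrow> real"
    and lam b R :: real
    and z :: 'a
  assumes nonexp: "nonexpansive T"
    and fixed: "T z = z"
    and lam_pos: "0 < lam"
    and \<delta>_nonneg: "\<And>n. 0 \<le> \<delta> n"
    and lam_\<delta>: "\<And>n. lam + \<delta> n \<le> 1"
    and \<delta>_le: "\<And>n. \<delta> n \<le> 1 / (real n + 1)\<^sup>2"
    and \<rho>_le: "\<And>n. norm (\<rho> n) \<le> R / (real n + 1)\<^sup>2"
    and X_Suc: "\<And>n. X (Suc n) = lam *\<^sub>R X n + (1 - lam - \<delta> n) *\<^sub>R T (X n) + \<rho> n"
    and X0_le: "norm (X 0 - z) \<le> b"
    and z_le: "norm z \<le> b"
begin

section \<open>Boundedness of the iterates\<close>

lemma R_nonneg: "0 \<le> R"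
  using order_trans[OF norm_ge_zero \<rho>_le[of 0]] by simp

lemma b_nonneg: "0 \<le> b"
  using order_trans[OF norm_ge_zero z_le] .

lemma \<delta>_le_1: "\<delta> n \<le> 1"
  using lam_\<delta>[of n] lam_pos by simp

lemma norm_T_diff_le: "norm (T (X n) - z) \<le> norm (X n - z)"
  using nonexp fixed unfolding nonexpansive_def by metis

lemma error_le: "\<delta> n * b + norm (\<rho> n) \<le> (b + R) / (real n + 1)\<^sup>2"
  using mult_right_mono[OF \<delta>_le[of n] b_nonneg] \<rho>_le[of n] by (simp add: add_divide_distrib)

text \<open>The weights sum to \<open>1 - \<delta> n\<close>, so subtracting \<open>z\<close> leaves
  over \<open>\<delta> n *\<^sub>R z\<close>, which joins the perturbation.\<close>

lemma X_Suc_minus_z: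
  "X (Suc n) - z = (lam *\<^sub>R (X n - z) + (1 - lam - \<delta> n) *\<^sub>R (T (X n) - z)) + (\<rho> n - \<delta> n *\<^sub>R z)"
  by (simp add: X_Suc algebra_simps)

lemma norm_perturbation_le: "norm (\<rho> n - \<delta> n *\<^sub>R z) \<le> \<delta> n * b + norm (\<rho> n)"
  using norm_triangle_ineq4[of "\<rho> n" "\<delta> n *\<^sub>R z"] mult_left_mono[OF z_le \<delta>_nonneg[of n]]
  by (simp add: \<delta>_nonneg)

lemma norm_combination_le:
  "norm (lam *\<^sub>R (X n - z) + (1 - lam - \<delta> n) *\<^sub>R (T (X n) - z)) \<le> (1 - \<delta> n) * norm (X n - z)"
proof -
  have "norm (lam *\<^sub>R (X n - z) + (1 - lam - \<delta> n) *\<^sub>R (T (X n) - z))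
      \<le> lam * norm (X n - z) + (1 - lam - \<delta> n) * norm (T (X n) - z)"
    using norm_triangle_ineq[of "lam *\<^sub>R (X n - z)" "(1 - lam - \<delta> n) *\<^sub>R (T (X n) - z)"]
      lam_pos lam_\<delta>[of n] by simp
  also have "\<dots> \<le> lam * norm (X n - z) + (1 - lam - \<delta> n) * norm (X n - z)"
    using lam_\<delta>[of n] by (intro add_left_mono mult_left_mono norm_T_diff_le) simp
  finally show ?thesis by (simp add: algebra_simps)
qed

text \<open>The contraction factor \<open>1 - \<delta> n\<close> pays for the term
  \<open>\<delta> n * b\<close>, so only the errors \<open>\<rho>\<close> accumulate. The term 2(1 -
  1/(n+1)) majorizes the partial sums of 1/(i+1)^2 and makes the induction close.\<close>

lemma norm_X_minus_z_le_strong: "norm (X n - z) \<le> b + 2 * R * (1 - 1 / (real n + 1))"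
proof (induction n)
  case 0
  show ?case using X0_le by simp
next
  case (Suc n)
  let ?B = "b + 2 * R * (1 - 1 / (real n + 1))"
  have "norm (X (Suc n) - z) \<le> (1 - \<delta> n) * norm (X n - z) + (\<delta> n * b + norm (\<rho> n))"
    unfolding X_Suc_minus_z
    by (rule norm_triangle_le[OF add_mono[OF norm_combination_le norm_perturbation_le]])
  \<comment> \<open>Since \<open>b \<le> ?B\<close>, the first two terms are dominated by a convex
    combination of \<open>?B\<close> with itself.\<close>
  also have "\<dots> \<le> (1 - \<delta> n) * ?B + (\<delta> n * ?B + R / (real n + 1)\<^sup>2)"
    using R_nonneg \<delta>_le_1[of n] \<delta>_nonneg[of n]
    by (intro add_mono mult_left_mono Suc.IH \<rho>_le) auto
  also have "\<dots> = ?B + R * (1 / (real n + 1)\<^sup>2)"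
    by (simp add: left_diff_distrib)
  also have "\<dots> \<le> ?B + R * (2 / (real n + 1) - 2 / (real (Suc n) + 1))"
  proof (intro add_left_mono mult_left_mono R_nonneg)
    have "1 / (real n + 1)\<^sup>2 \<le> 1 / ((real n + 1) * ((real n + 2) / 2))"
      unfolding power2_eq_square by (intro divide_left_mono mult_left_mono) auto
    also have "\<dots> = 2 / (real n + 1) - 2 / (real (Suc n) + 1)"
      by (simp add: field_simps)
    finally show "1 / (real n + 1)\<^sup>2 \<le> 2 / (real n + 1) - 2 / (real (Suc n) + 1)" .
  qed
  finally show ?case by (simp add: algebra_simps)
qed

lemma norm_X_minus_z_le: "norm (X n - z) \<le> b + 2 * R"
proof -
  have "2 * R * (1 - 1 / (real n + 1)) \<le> 2 * R * 1"
    using R_nonneg by (intro mult_left_mono) auto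
  with norm_X_minus_z_le_strong[of n] show ?thesis by simp
qed

section \<open>Growth of the residuals\<close>

lemma norm_T_X_le: "norm (T (X n)) \<le> 2 * b + 2 * R"
  using norm_T_diff_le[of n] norm_X_minus_z_le[of n] z_le
    norm_triangle_ineq[of "T (X n) - z" z] by simp

text \<open>This vector is the deviation of \<open>X (Suc n)\<close> from the exact step
  \<open>lam *\<^sub>R X n + (1 - lam) *\<^sub>R T (X n)\<close>.\<close>

lemma norm_defect_le:
  "norm (\<rho> n - \<delta> n *\<^sub>R T (X n)) \<le> (2 * b + 3 * R) / (real n + 1)\<^sup>2"
proof -
  have "norm (\<rho> n - \<delta> n *\<^sub>R T (X n)) \<le> norm (\<rho> n) + \<delta> n * norm (T (X n))"
    using norm_triangle_ineq4[of "\<rho> n" "\<delta> n *\<^sub>R T (X n)"] by (simp add: \<delta>_nonneg)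
  also have "\<dots> \<le> R / (real n + 1)\<^sup>2 + 1 / (real n + 1)\<^sup>2 * (2 * b + 2 * R)"
    by (intro add_mono mult_mono \<rho>_le \<delta>_le norm_T_X_le) auto
  also have "\<dots> = (2 * b + 3 * R) / (real n + 1)\<^sup>2"
    by (simp add: field_simps)
  finally show ?thesis .
qed

lemma norm_step_le:
  "norm (X (Suc n) - X n)
    \<le> (1 - lam) * norm (X n - T (X n)) + (2 * b + 3 * R) / (real n + 1)\<^sup>2"
proof -
  have "X (Suc n) - X n = (1 - lam) *\<^sub>R (T (X n) - X n) + (\<rho> n - \<delta> n *\<^sub>R T (X n))"
    by (simp add: X_Suc algebra_simps)
  moreover have "0 \<le> 1 - lam"
    using lam_\<delta>[of 0] \<delta>_nonneg[of 0] by linarith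
  ultimately show ?thesis
    using norm_triangle_le[OF add_mono[OF order_refl norm_defect_le[of n]],
        of "(1 - lam) *\<^sub>R (T (X n) - X n)"]
    by (simp add: norm_minus_commute)
qed

text \<open>Passing through \<open>T (X n)\<close> gives two pieces with coefficients
  \<open>lam\<close> and \<open>1 - lam\<close> of the old residual. These add up to exactly 1, and
  the defect is paid once in each piece.\<close>

lemma residual_Suc_le:
  "norm (X (Suc n) - T (X (Suc n)))
    \<le> norm (X n - T (X n)) + 2 * ((2 * b + 3 * R) / (real n + 1)\<^sup>2)"
proof -
  have "X (Suc n) - T (X n) = lam *\<^sub>R (X n - T (X n)) + (\<rho> n - \<delta> n *\<^sub>R T (X n))"
    by (simp add: X_Suc algebra_simps)
  then have "norm (X (Suc n) - T (X n))
      \<le> lam * norm (X n - T (X n)) + (2 * b + 3 * R) / (real n + 1)\<^sup>2"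
    using norm_triangle_le[OF add_mono[OF order_refl norm_defect_le[of n]],
        of "lam *\<^sub>R (X n - T (X n))"] lam_pos by simp
  moreover have "norm (T (X n) - T (X (Suc n))) \<le> norm (X (Suc n) - X n)"
    using nonexp unfolding nonexpansive_def by (metis norm_minus_commute)
  moreover have "norm (X (Suc n) - T (X (Suc n)))
      \<le> norm (X (Suc n) - T (X n)) + norm (T (X n) - T (X (Suc n)))"
    using norm_triangle_ineq[of "X (Suc n) - T (X n)" "T (X n) - T (X (Suc n))"] by simp
  ultimately show ?thesis
    using norm_step_le[of n, unfolded left_diff_distrib mult_1_left] by linarith
qed

lemma residual_le_later:
  assumes "1 \<le> m" "m \<le> n"
  shows "norm (X n - T (X n)) \<le> norm (X m - T (X m)) + (4 * b + 6 * R) / real m"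
proof -
  let ?q = "\<lambda>n. norm (X n - T (X n)) + (4 * b + 6 * R) / real n"
  have "?q n \<le> ?q m"
    using assms(2)
  proof (induction n rule: dec_induct)
    case (step n)
    have "(4 * b + 6 * R) * (1 / (real n + 1)\<^sup>2)
        \<le> (4 * b + 6 * R) * (1 / real n - 1 / real (Suc n))"
      using assms(1) step b_nonneg R_nonneg
      by (intro mult_left_mono inverse_square_le_telescope) auto
    with residual_Suc_le[of n] step.IH show ?case
      by (simp add: algebra_simps add_divide_distrib)
  qed simp
  moreover have "0 \<le> (4 * b + 6 * R) / real n"
    using b_nonneg R_nonneg by simp
  ultimately show ?thesis by linarith
qed

section \<open>Energy decrease and extraction of a rate\<close>

lemma energy_Suc_le:
  assumes "1 \<le> n"
  shows "((norm (X (Suc n) - z))\<^sup>2 + (b + R) * (3 * b + 5 * R) / real (Suc n))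
      + lam * (1 - lam - \<delta> n) * (norm (X n - T (X n)))\<^sup>2
    \<le> (norm (X n - z))\<^sup>2 + (b + R) * (3 * b + 5 * R) / real n"
proof -
  let ?u = "X n - z" and ?v = "T (X n) - z" and ?\<beta> = "1 - lam - \<delta> n"
  let ?w = "lam *\<^sub>R ?u + ?\<beta> *\<^sub>R ?v" and ?e = "(b + R) / (real n + 1)\<^sup>2"
  have \<beta>: "0 \<le> ?\<beta>" using lam_\<delta>[of n] by simp
  have s: "0 \<le> 1 - \<delta> n" "1 - \<delta> n \<le> 1"
    using \<delta>_le_1[of n] \<delta>_nonneg[of n] by simp_all
  have e_nonneg: "0 \<le> ?e" using b_nonneg R_nonneg by simp
  have "?e \<le> (b + R) / 1"
    using b_nonneg R_nonneg by (intro divide_left_mono) (auto intro: one_le_power)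
  then have e_le: "?e \<le> b + R" by simp
  \<comment> \<open>In \<open>?u - ?v\<close> the point \<open>z\<close> cancels, so the negative
    term of the identity is the squared residual.\<close>
  have "(norm ?w)\<^sup>2 = lam * (1 - \<delta> n) * (norm ?u)\<^sup>2 + ?\<beta> * (1 - \<delta> n) * (norm ?v)\<^sup>2
      - lam * ?\<beta> * (norm (X n - T (X n)))\<^sup>2"
    using norm_scaleR_add_sq[of lam ?u ?\<beta> ?v] by simp
  also have "\<dots> \<le> lam * (1 - \<delta> n) * (norm ?u)\<^sup>2 + ?\<beta> * (1 - \<delta> n) * (norm ?u)\<^sup>2
      - lam * ?\<beta> * (norm (X n - T (X n)))\<^sup>2"
    using \<beta> s by (intro diff_right_mono add_left_mono mult_left_mono power_mono norm_T_diff_le) auto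
  also have "\<dots> = (1 - \<delta> n)\<^sup>2 * (norm ?u)\<^sup>2 - lam * ?\<beta> * (norm (X n - T (X n)))\<^sup>2"
    by (simp add: power2_eq_square algebra_simps)
  also have "\<dots> \<le> 1 * (norm ?u)\<^sup>2 - lam * ?\<beta> * (norm (X n - T (X n)))\<^sup>2"
    using s by (intro diff_right_mono mult_right_mono power_le_one) auto
  finally have w_sq: "(norm ?w)\<^sup>2 \<le> (norm ?u)\<^sup>2 - lam * ?\<beta> * (norm (X n - T (X n)))\<^sup>2"
    by simp
  have "(1 - \<delta> n) * norm ?u \<le> 1 * norm ?u"
    using s by (intro mult_right_mono) auto
  then have w_le: "norm ?w \<le> b + 2 * R"
    using norm_combination_le[of n] norm_X_minus_z_le[of n] by linarith
  have "norm (X (Suc n) - z) \<le> norm ?w + ?e"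
    unfolding X_Suc_minus_z
    using order_trans[OF norm_perturbation_le error_le]
    by (intro norm_triangle_le add_left_mono)
  then have "(norm (X (Suc n) - z))\<^sup>2 \<le> (norm ?w + ?e)\<^sup>2"
    by (intro power_mono) auto
  also have "\<dots> = (norm ?w)\<^sup>2 + ?e * (2 * norm ?w + ?e)"
    by (simp only: power2_sum) (simp only: power2_eq_square distrib_left ac_simps)
  \<comment> \<open>One factor \<open>?e\<close> is kept because it carries the summable 1/(n+1)^2;
    the bracket is bounded by the constant 2(b + 2R) + (b + R) = 3b + 5R.\<close>
  also have "\<dots> \<le> (norm ?w)\<^sup>2 + ?e * (2 * (b + 2 * R) + (b + R))"
    using w_le e_le e_nonneg by (intro add_left_mono mult_left_mono) auto
  also have "\<dots> = (norm ?w)\<^sup>2 + (b + R) * (3 * b + 5 * R) * (1 / (real n + 1)\<^sup>2)"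
    by (simp add: field_simps)
  also have "\<dots> \<le> (norm ?w)\<^sup>2 + (b + R) * (3 * b + 5 * R) * (1 / real n - 1 / real (Suc n))"
    using b_nonneg R_nonneg
    by (intro add_left_mono mult_left_mono inverse_square_le_telescope assms) auto
  finally show ?thesis
    using w_sq by (simp add: right_diff_distrib)
qed

text \<open>Coefficientwise comparison of polynomials in \<open>b, R \<ge> 0\<close>. The factor 3
  is chosen to cancel the 3 in the lower bound \<open>3 / (4 * A)\<close> used in
  \<open>residual_small\<close>.\<close>

lemma energy_const_le:
  assumes "1 \<le> m"
  shows "(norm (X m - z))\<^sup>2 + (b + R) * (3 * b + 5 * R) / real m
    \<le> 3 * ((3 * b + 2 * R) * (5 * b + 4 * R + 1))"
proof -
  have "(norm (X m - z))\<^sup>2 \<le> (b + 2 * R)\<^sup>2"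
    by (intro power_mono norm_X_minus_z_le) auto
  moreover have "(b + R) * (3 * b + 5 * R) / real m \<le> (b + R) * (3 * b + 5 * R)"
  proof -
    have "(b + R) * (3 * b + 5 * R) * 1 \<le> (b + R) * (3 * b + 5 * R) * real m"
      using assms b_nonneg R_nonneg by (intro mult_left_mono) auto
    then show ?thesis using assms by (simp add: divide_le_eq)
  qed
  moreover have "(b + 2 * R)\<^sup>2 + (b + R) * (3 * b + 5 * R)
      \<le> 3 * ((3 * b + 2 * R) * (5 * b + 4 * R + 1))"
  proof -
    have "0 \<le> b * b" "0 \<le> b * R" "0 \<le> R * R"
      using b_nonneg R_nonneg by simp_all
    moreover have "3 * ((3 * b + 2 * R) * (5 * b + 4 * R + 1))
        - ((b + 2 * R)\<^sup>2 + (b + R) * (3 * b + 5 * R))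
        = 41 * (b * b) + 54 * (b * R) + 15 * (R * R) + 9 * b + 6 * R"
      by (simp add: power2_eq_square algebra_simps)
    ultimately show ?thesis using b_nonneg R_nonneg by linarith
  qed
  ultimately show ?thesis by linarith
qed

text \<open>The tolerance \<open>1 / c\<close> is halved. A window of length \<open>W\<close>
  starting at \<open>m\<close> contains an index with residual at most \<open>1 / (2 * c)\<close>,
  and \<open>m\<close> is so large that later growth adds at most another
  \<open>1 / (2 * c)\<close>. In the application \<open>A\<close> is \<open>\<Lambda>\<close> and
  \<open>c\<close> is \<open>k + 1\<close>.\<close>

lemma residual_small:
  fixes A c :: real and m W n :: nat
  assumes A: "0 < A" and coeff: "\<And>n. m \<le> n \<Longrightarrow> 3 / (4 * A) \<le> lam * (1 - lam - \<delta> n)"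
    and c: "0 < c"
    and m: "1 \<le> m" "2 * (4 * b + 6 * R) * c \<le> real m"
    and W: "0 < W" "16 * A * ((3 * b + 2 * R) * (5 * b + 4 * R + 1)) * c\<^sup>2 \<le> real W"
    and n: "m + W \<le> n"
  shows "norm (X n - T (X n)) \<le> 1 / c"
proof -
  let ?M = "(3 * b + 2 * R) * (5 * b + 4 * R + 1)"
  let ?d = "\<lambda>n. norm (X n - T (X n))"
  obtain i where i: "m \<le> i" "i < m + W"
    and drop: "real W * (lam * (1 - lam - \<delta> i) * (?d i)\<^sup>2)
      \<le> (norm (X m - z))\<^sup>2 + (b + R) * (3 * b + 5 * R) / real m"
    using decreasing_imp_small_drop[of m
        "\<lambda>n. (norm (X n - z))\<^sup>2 + (b + R) * (3 * b + 5 * R) / real n"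
        "\<lambda>n. lam * (1 - lam - \<delta> n) * (?d n)\<^sup>2" W]
      energy_Suc_le m W b_nonneg R_nonneg by force
  have "real W * (3 / (4 * A) * (?d i)\<^sup>2) \<le> real W * (lam * (1 - lam - \<delta> i) * (?d i)\<^sup>2)"
    using coeff[OF i(1)] by (intro mult_left_mono mult_right_mono) auto
  also have "\<dots> \<le> 3 * ?M"
    using drop energy_const_le[OF m(1)] by linarith
  finally have "real W * (?d i)\<^sup>2 \<le> 4 * A * ?M"
    using A by (simp add: field_simps)
  then have le: "4 * c\<^sup>2 * (real W * (?d i)\<^sup>2) \<le> 4 * c\<^sup>2 * (4 * A * ?M)"
    by (intro mult_left_mono) auto
  have "real W * (2 * c * ?d i)\<^sup>2 = 4 * c\<^sup>2 * (real W * (?d i)\<^sup>2)"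
    by (simp add: power_mult_distrib)
  also note le
  also have "4 * c\<^sup>2 * (4 * A * ?M) = 16 * A * ?M * c\<^sup>2"
    by simp
  also note W(2)
  finally have "(2 * c * ?d i)\<^sup>2 \<le> 1\<^sup>2"
    using W(1) by simp
  then have "2 * c * ?d i \<le> 1"
    by (rule power2_le_imp_le) simp
  then have "?d i \<le> 1 / (2 * c)"
    using c by (simp add: field_simps)
  moreover have "?d n \<le> ?d i + (4 * b + 6 * R) / real i"
    using i m n by (intro residual_le_later) auto
  moreover have "(4 * b + 6 * R) / real i \<le> 1 / (2 * c)"
  proof -
    have "2 * (4 * b + 6 * R) * c \<le> real i"
      using m i by linarith
    then show ?thesis using m i c by (simp add: field_simps)
  qed
  moreover have "1 / (2 * c) + 1 / (2 * c) = 1 / c"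
    by simp
  ultimately show ?thesis by linarith
qed

end

section \<open>Explicit rates for the given iteration\<close>

theorem proposition5p5:
  fixes T :: "'a::{real_inner, complete_space} \<Rightarrow> 'a"
    and J L b \<Lambda> R M1 M2 :: nat
    and lam :: real
    and rstar x :: 'a
    and X :: "nat \<Rightarrow> 'a"
  assumes "nonexpansive T"
    and "Fix T \<noteq> {}"
    and "J \<ge> 2"
    and "L \<ge> 1"
    and "0 < lam" and "lam < ((real J)^2 - 1) / (real J)^2"
    and "X 0 = x"
    and "\<And>n. X (Suc n) =
           lam *\<^sub>R X n
           + (1 - lam - 1 / (real n + real J)^2) *\<^sub>R T (X n)
           + (1 / (real n + real L)^2) *\<^sub>R rstar"
    and "\<Lambda> = nat \<lceil>1 / (lam * (1 - lam))\<rceil>"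
    and "b \<ge> 1"
    and "\<exists>z\<in>Fix T. real b \<ge> max (norm (x - z)) (norm z)"
    and "R = nat \<lceil>norm rstar\<rceil>"
    and "M1 = (3 * b + 2 * R) * (5 * b + 4 * R + 1)"
    and "M2 = 2 * b + R"
  shows "T_asymptotically_regular_with_rate T X
           (\<lambda>k. 16 * \<Lambda> * M1 * (k + 1)^2 + 16 * \<Lambda> * M2 * (k + 1) + 3 * \<Lambda> - 1) \<and>
         asymptotically_regular_with_rate X
           (\<lambda>k. 64 * \<Lambda> * M1 * (k + 1)^2 + 32 * \<Lambda> * M2 * (k + 1) + 3 * \<Lambda> - 1)"
proof -
  define \<delta> where "\<delta> = (\<lambda>n. 1 / (real n + real J)^2)"
  define \<rho> where "\<rho> = (\<lambda>n. (1 / (real n + real L)^2) *\<^sub>R rstar)"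
  obtain z where z: "T z = z" "norm (x - z) \<le> real b" "norm z \<le> real b"
    using assms(11) by (auto simp: Fix_def)
  have rstar_le: "norm rstar \<le> real R"
    using assms(12) by simp
  \<comment> \<open>This rewrites the upper bound on \<open>lam\<close>; it keeps the weight of
    \<open>T (X n)\<close> nonnegative for every \<open>n\<close>.\<close>
  have "1 / (real J)^2 < 1 - lam"
    using assms(3,6) by (simp add: field_simps)
  moreover have "\<delta> n \<le> 1 / (real J)^2" for n
    unfolding \<delta>_def using assms(3) by (intro divide_left_mono power_mono) auto
  ultimately have \<delta>_lam: "lam + \<delta> n \<le> 1" for n
    by (smt (verit))
  interpret perturbed_krasnoselskii_mann T X \<rho> \<delta> lam "real b" "real R" z
  proof
    show "\<delta> n \<le> 1 / (real n + 1)\<^sup>2" for n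
      unfolding \<delta>_def using assms(3) by (intro divide_left_mono power_mono) auto
    show "norm (\<rho> n) \<le> real R / (real n + 1)\<^sup>2" for n
    proof -
      have "norm (\<rho> n) = norm rstar / (real n + real L)^2"
        by (simp add: \<rho>_def)
      also have "\<dots> \<le> real R / (real n + 1)\<^sup>2"
        using rstar_le assms(4) by (intro frac_le power_mono) auto
      finally show ?thesis .
    qed
    show "X (Suc n) = lam *\<^sub>R X n + (1 - lam - \<delta> n) *\<^sub>R T (X n) + \<rho> n" for n
      using assms(8) by (simp add: \<delta>_def \<rho>_def)
    show "0 \<le> \<delta> n" for n by (simp add: \<delta>_def)
  qed (use assms z \<delta>_lam in auto)
  have lam_less: "lam < 1"
    using \<open>1 / (real J)^2 < 1 - lam\<close> zero_le_power2[of "real J"]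
    by (smt (verit) divide_nonneg_nonneg)
  define \<mu> where "\<mu> = lam * (1 - lam)"
  have \<mu>: "0 < \<mu>" "\<mu> \<le> 1 / 4" "\<mu> \<le> 1 - lam"
  proof -
    show "0 < \<mu>" using assms(5) lam_less by (simp add: \<mu>_def)
    have "0 \<le> (lam - 1 / 2)\<^sup>2" by simp
    then show "\<mu> \<le> 1 / 4" by (simp add: \<mu>_def power2_eq_square algebra_simps)
    show "\<mu> \<le> 1 - lam"
      using assms(5) lam_less by (simp add: \<mu>_def mult_left_le_one_le)
  qed
  have "1 / \<mu> \<le> real \<Lambda>"
    using assms(9) \<mu>_def by (simp add: real_nat_ceiling_ge)
  moreover have "4 \<le> 1 / \<mu>"
    using \<mu> by (simp add: field_simps)
  ultimately have \<Lambda>: "1 / real \<Lambda> \<le> \<mu>" "4 \<le> real \<Lambda>"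
    using \<mu>(1) by (simp add: divide_le_eq mult.commute, linarith)
  \<comment> \<open>From \<Lambda> \<ge> 4 and n \<ge> \<Lambda> follows (n + J)^2 \<ge> 4\<Lambda>.
    Hence \<open>\<delta> n\<close> takes at most a quarter of \<open>1 - lam\<close>, and three
    quarters of \<open>\<mu> \<ge> 1 / \<Lambda>\<close> remain.\<close>
  have coeff: "3 / (4 * real \<Lambda>) \<le> lam * (1 - lam - \<delta> n)" if "\<Lambda> \<le> n" for n
  proof -
    have "4 * real \<Lambda> \<le> real \<Lambda> * real \<Lambda>"
      using \<Lambda> by (intro mult_right_mono) auto
    also have "\<dots> \<le> (real n + real J)^2"
      using that unfolding power2_eq_square by (intro mult_mono) auto
    finally have "\<delta> n \<le> 1 / (4 * real \<Lambda>)"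
      unfolding \<delta>_def using \<Lambda>(2) by (intro frac_le) auto
    also have "\<dots> \<le> (1 - lam) / 4"
      using \<Lambda>(1) \<mu>(3) by simp
    finally have "3 / 4 * (1 - lam) \<le> 1 - lam - \<delta> n"
      by (simp add: field_simps)
    then have "lam * (3 / 4 * (1 - lam)) \<le> lam * (1 - lam - \<delta> n)"
      using assms(5) by (intro mult_left_mono) auto
    moreover have "lam * (3 / 4 * (1 - lam)) = 3 / 4 * \<mu>"
      by (simp add: \<mu>_def)
    moreover have "3 / (4 * real \<Lambda>) = 3 / 4 * (1 / real \<Lambda>)"
      by simp
    ultimately show ?thesis using \<Lambda>(1) by linarith
  qed
  have \<Lambda>4: "4 \<le> \<Lambda>" using \<Lambda>(2) by linarith
  have M1_pos: "0 < M1" using assms(10,13) by simp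
  have M1_real: "real M1 = (3 * real b + 2 * real R) * (5 * real b + 4 * real R + 1)"
    unfolding assms(13) by (simp add: algebra_simps)
  let ?\<Phi> = "\<lambda>k. 16 * \<Lambda> * M1 * (k + 1)^2 + 16 * \<Lambda> * M2 * (k + 1) + 3 * \<Lambda> - 1"
  \<comment> \<open>Start of the window: the summand \<open>\<Lambda>\<close> makes
    \<open>coeff\<close> applicable, the \<open>M2\<close> term controls the later growth. The
    \<open>M1\<close> term of \<open>?\<Phi>\<close> is the window length.\<close>
  let ?m = "\<lambda>k. 16 * \<Lambda> * M2 * (k + 1) + \<Lambda>"
  have m_ge: "2 * (4 * real b + 6 * real R) * (real k + 1) \<le> real (?m k)" for k
  proof -
    have "2 * (4 * b + 6 * R) \<le> 64 * M2"
      using assms(14) by simp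
    also have "\<dots> \<le> 16 * \<Lambda> * M2"
      using \<Lambda>4 by (intro mult_right_mono) auto
    finally have "2 * (4 * b + 6 * R) * (k + 1) \<le> 16 * \<Lambda> * M2 * (k + 1)"
      by (rule mult_right_mono) simp
    then have "2 * (4 * b + 6 * R) * (k + 1) \<le> ?m k"
      by simp
    then have "real (2 * (4 * b + 6 * R) * (k + 1)) \<le> real (?m k)"
      by (rule of_nat_mono)
    then show ?thesis by (simp add: algebra_simps)
  qed
  have residual: "norm (X n - T (X n)) \<le> 1 / (real k + 1)" if "?\<Phi> k \<le> n" for k n
  proof (rule residual_small)
    show "?m k + 16 * \<Lambda> * M1 * (k + 1)^2 \<le> n"
      using that \<Lambda>4 by linarith
    show "3 / (4 * real \<Lambda>) \<le> lam * (1 - lam - \<delta> i)" if "?m k \<le> i" for i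
      using that by (intro coeff) linarith
    show "16 * real \<Lambda> * ((3 * real b + 2 * real R) * (5 * real b + 4 * real R + 1)) * (real k + 1)\<^sup>2
        \<le> real (16 * \<Lambda> * M1 * (k + 1)^2)"
      unfolding M1_real[symmetric] by (simp add: add.commute)
  qed (use m_ge[of k] \<Lambda>4 M1_pos in auto)
  have step: "norm (X (Suc n) - X n) \<le> 1 / (real k + 1)"
    if "64 * \<Lambda> * M1 * (k + 1)^2 + 32 * \<Lambda> * M2 * (k + 1) + 3 * \<Lambda> - 1 \<le> n" for k n
  proof -
    \<comment> \<open>As (2k + 1) + 1 = 2(k + 1), this index gives half the tolerance, and the
      constants 16 become 64 and 32. The other half is left for the defect.\<close>
    have "?\<Phi> (2 * k + 1) = 64 * \<Lambda> * M1 * (k + 1)^2 + 32 * \<Lambda> * M2 * (k + 1) + 3 * \<Lambda> - 1"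
      by (simp add: power2_eq_square algebra_simps)
    with that have \<Phi>: "?\<Phi> (2 * k + 1) \<le> n" by simp
    have d: "norm (X n - T (X n)) \<le> 1 / (2 * (real k + 1))"
      using residual[OF \<Phi>] by (simp add: algebra_simps)
    have "(1 - lam) * norm (X n - T (X n)) \<le> norm (X n - T (X n))"
      using assms(5) lam_less by (intro mult_left_le_one_le) auto
    moreover have "(2 * real b + 3 * real R) / (real n + 1)\<^sup>2 \<le> 1 / (2 * (real k + 1))"
    proof -
      have "?m k \<le> n"
        using that \<Lambda>4 by (simp add: algebra_simps)
      then have "2 * (4 * real b + 6 * real R) * (real k + 1) \<le> real n + 1"
        using m_ge[of k] by linarith
      moreover have "(2 * real b + 3 * real R) * (2 * (real k + 1))
          \<le> 2 * (4 * real b + 6 * real R) * (real k + 1)"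
        by (simp add: algebra_simps)
      \<comment> \<open>The linear lower bound on \<open>n\<close> from \<open>m_ge\<close> already
        suffices for the quadratic denominator.\<close>
      moreover have "real n + 1 \<le> (real n + 1)\<^sup>2"
        by (rule self_le_power) auto
      ultimately have "(2 * real b + 3 * real R) * (2 * (real k + 1)) \<le> (real n + 1)\<^sup>2"
        by linarith
      then show ?thesis by (simp add: divide_simps)
    qed
    ultimately have "norm (X (Suc n) - X n) \<le> 1 / (2 * (real k + 1)) + 1 / (2 * (real k + 1))"
      using norm_step_le[of n] d by linarith
    then show ?thesis by (simp add: field_simps)
  qed
  show ?thesis
    unfolding T_asymptotically_regular_with_rate_def asymptotically_regular_with_rate_def
      rate_of_convergence_to_0_def
    using residual step by simp
qed

end
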